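(* Let $(P,d)$ be a finite metric space with $P=H_1\cupdot\dots\cupdot H_m$, let $t_2,\dots,t_m\in\mathbb N$ with $|H_i|\ge t_i|H_1|$ for $2\le i\le m$, and $k\ge1$. Let $\mathrm{OPT}_{\mathrm{fair}}$ be the radius (cost) of an optimal $1:t_2:\dots:t_m$-fair $k$-center with outliers solution (with $|H_i|-t_i|H_1|$ outliers from $H_i$, $2\le i\le m$). Then the algorithm \textsc{compute-$1:t_2:\dots:t_m$-fairlets} described in the context, with threshold factor $\tau=2$, computes a $1:t_2:\dots:t_m$-fairlet decomposition $\mathcal F$ with $d(h_1,p)\le2\,\mathrm{OPT}_{\mathrm{fair}}$ for every $f\in\mathcal F$, the anchor $h_1\in f\cap H_1$ of $f$, and every point $p\in f\cap(H_2\cup\dots\cup H_m)$.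
   Context: Put $t_1=1$. A $1:t_2:\dots:t_m$-fairlet is a set $f\subseteq P$ with $|f\cap H_i|=t_i$ for all $i\le m$; a fairlet decomposition is a maximal set of pairwise disjoint fairlets. The anchor of a fairlet is its unique point in $H_1$. A $1:t_2:\dots:t_m$-fair $k$-clustering with outliers is a set $C\subseteq P$ of at most $k$ centers and a map $\alpha:P\to C\cup\{\perp\}$ such that each cluster $Q=\alpha^{-1}(c)$ satisfies $|Q\cap H_i|=t_i|Q\cap H_1|$ for all $i$; the outliers are $\alpha^{-1}(\perp)$, with exactly $|H_i|-t_i|H_1|$ of them in $H_i$ for $i\ge2$ and none in $H_1$. The cost is $\max_{\alpha(x)\neq\perp}d(x,\alpha(x))$. \textsc{compute-$1:t$-fairlets}$(P,R,B)$ with threshold factor $\tau$, for disjoint $R,B\subseteq P$: let $D=\{d(x,y):x,y\in P\}$, sorted increasingly. For $\delta\in D$ in this order build the flow network with vertices $B\cup R\cup\{v,w\}$, source $v$, sink $w$, edges $(v,b)$ of capacity $1$ ($b\in B$), edges $(b,r)$ of capacity $1$ ($b\in B,r\in R$, $d(b,r)\le\tau\delta$), and edges $(r,w)$ of capacity $t$ ($r\in R$); compute a maximum integral flow $\mathbf f$. At the first $\delta$ with $|\mathbf f|=t|R|$ return $\{f_r:r\in R\}$, $f_r=\{r\}\cup\{b\in B:\mathbf f(b,r)=1\}$. \textsc{compute-$1:t_2:\dots:t_m$-fairlets}: for each $i=2,\dots,m$ let $\mathcal F_i$ be the output of \textsc{compute-$1:t_i$-fairlets}$(P,H_1,H_i)$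 with threshold factor $\tau$. For each $h_1\in H_1$ form the union over $2\le i\le m$ of the fairlets of $\mathcal F_i$ containing $h_1$; this is a fairlet with anchor $h_1$. Return the set $\mathcal F$ of all these. *)

theory Defs
  imports "HOL-Analysis.Abstract_Metric_Spaces" "HOL-Library.Disjoint_Sets"
begin

section \<open>Fairlets\<close>

text \<open>The colour classes are \<open>H 1, \<dots>, H m\<close> and the ratios \<open>t 1, \<dots>, t m\<close>, where the
  theorem assumes \<open>t 1 = 1\<close>. Values of \<open>H\<close> and \<open>t\<close> at other indices are irrelevant.\<close>

definition fairlet :: "'a set \<Rightarrow> nat \<Rightarrow> (nat \<Rightarrow> 'a set) \<Rightarrow> (nat \<Rightarrow> nat) \<Rightarrow> 'a set \<Rightarrow> bool" where
  "fairlet P m H t f \<longleftrightarrow> f \<subseteq> P \<and> (\<forall>i\<in>{1..m}. card (f \<inter> H i) = t i)"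

definition disjoint_fairlets ::
    "'a set \<Rightarrow> nat \<Rightarrow> (nat \<Rightarrow> 'a set) \<Rightarrow> (nat \<Rightarrow> nat) \<Rightarrow> 'a set set \<Rightarrow> bool" where
  "disjoint_fairlets P m H t F \<longleftrightarrow> (\<forall>f\<in>F. fairlet P m H t f) \<and> pairwise disjnt F"

definition fairlet_decomposition ::
    "'a set \<Rightarrow> nat \<Rightarrow> (nat \<Rightarrow> 'a set) \<Rightarrow> (nat \<Rightarrow> nat) \<Rightarrow> 'a set set \<Rightarrow> bool" where
  "fairlet_decomposition P m H t F \<longleftrightarrow>
     disjoint_fairlets P m H t F \<and>
     (\<forall>G. disjoint_fairlets P m H t G \<and> F \<subseteq> G \<longrightarrow> G = F)"

definition anchor :: "(nat \<Rightarrow> 'a set) \<Rightarrow> 'a set \<Rightarrow> 'a" where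
  "anchor H f = (THE h. h \<in> f \<inter> H 1)"

section \<open>Fair clusterings with outliers\<close>

text \<open>\<open>\<alpha> x = None\<close> means that \<open>x\<close> is an outlier. Only the values of \<open>\<alpha>\<close> on \<open>P\<close> matter.\<close>

definition fair_clustering ::
    "'a set \<Rightarrow> nat \<Rightarrow> (nat \<Rightarrow> 'a set) \<Rightarrow> (nat \<Rightarrow> nat) \<Rightarrow> nat \<Rightarrow> 'a set \<Rightarrow> ('a \<Rightarrow> 'a option) \<Rightarrow> bool" where
  "fair_clustering P m H t k C \<alpha> \<longleftrightarrow>
     C \<subseteq> P \<and> card C \<le> k \<and>
     (\<forall>x\<in>P. \<alpha> x \<in> Some ` C \<union> {None}) \<and>
     (\<forall>c\<in>C. let Q = {x \<in> P. \<alpha> x = Some c} in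
        \<forall>i\<in>{1..m}. card (Q \<inter> H i) = t i * card (Q \<inter> H 1)) \<and>
     {x \<in> H 1. \<alpha> x = None} = {} \<and>
     (\<forall>i\<in>{2..m}. card {x \<in> H i. \<alpha> x = None} = card (H i) - t i * card (H 1))"

text \<open>Distances are nonnegative, so inserting \<open>0\<close> only fixes the cost to be \<open>0\<close> when every
  point is an outlier (which is possible only for \<open>H 1 = {}\<close>).\<close>

definition clustering_cost :: "'a set \<Rightarrow> ('a \<Rightarrow> 'a \<Rightarrow> real) \<Rightarrow> ('a \<Rightarrow> 'a option) \<Rightarrow> real" where
  "clustering_cost P d \<alpha> = Max (insert 0 {d x (the (\<alpha> x)) | x. x \<in> P \<and> \<alpha> x \<noteq> None})"

text \<open>For finite \<open>P\<close> only finitely many costs occur, so the minimum is over a finite set.\<close>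

definition opt_fair ::
    "'a set \<Rightarrow> ('a \<Rightarrow> 'a \<Rightarrow> real) \<Rightarrow> nat \<Rightarrow> (nat \<Rightarrow> 'a set) \<Rightarrow> (nat \<Rightarrow> nat) \<Rightarrow> nat \<Rightarrow> real" where
  "opt_fair P d m H t k =
     Min {clustering_cost P d \<alpha> | C \<alpha>. fair_clustering P m H t k C \<alpha>}"

section \<open>Integral flows\<close>

definition integral_flow ::
    "'v set \<Rightarrow> ('v \<times> 'v) set \<Rightarrow> ('v \<times> 'v \<Rightarrow> nat) \<Rightarrow> 'v \<Rightarrow> 'v \<Rightarrow> ('v \<times> 'v \<Rightarrow> nat) \<Rightarrow> bool" where
  "integral_flow V E cap s w \<phi> \<longleftrightarrow>
     (\<forall>e\<in>E. \<phi> e \<le> cap e) \<and> (\<forall>e. e \<notin> E \<longrightarrow> \<phi> e = 0) \<and>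
     (\<forall>u\<in>V - {s, w}. (\<Sum>e | e \<in> E \<and> snd e = u. \<phi> e) = (\<Sum>e | e \<in> E \<and> fst e = u. \<phi> e))"

definition flow_value :: "('v \<times> 'v) set \<Rightarrow> 'v \<Rightarrow> ('v \<times> 'v \<Rightarrow> nat) \<Rightarrow> int" where
  "flow_value E s \<phi> =
     int (\<Sum>e | e \<in> E \<and> fst e = s. \<phi> e) - int (\<Sum>e | e \<in> E \<and> snd e = s. \<phi> e)"

definition max_integral_flow ::
    "'v set \<Rightarrow> ('v \<times> 'v) set \<Rightarrow> ('v \<times> 'v \<Rightarrow> nat) \<Rightarrow> 'v \<Rightarrow> 'v \<Rightarrow> ('v \<times> 'v \<Rightarrow> nat) \<Rightarrow> bool" where
  "max_integral_flow V E cap s w \<phi> \<longleftrightarrow>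
     integral_flow V E cap s w \<phi> \<and>
     (\<forall>\<psi>. integral_flow V E cap s w \<psi> \<longrightarrow> flow_value E s \<psi> \<le> flow_value E s \<phi>)"

section \<open>The algorithms\<close>

datatype 'a vertex = Source | Sink | Point 'a

definition net_vertices :: "'a set \<Rightarrow> 'a set \<Rightarrow> 'a vertex set" where
  "net_vertices R B = Point ` (B \<union> R) \<union> {Source, Sink}"

definition net_edges ::
    "('a \<Rightarrow> 'a \<Rightarrow> real) \<Rightarrow> 'a set \<Rightarrow> 'a set \<Rightarrow> real \<Rightarrow> ('a vertex \<times> 'a vertex) set" where
  "net_edges d R B \<theta> =
     {(Source, Point b) | b. b \<in> B} \<union>
     {(Point b, Point r) | b r. b \<in> B \<and> r \<in> R \<and> d b r \<le> \<theta>} \<union>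
     {(Point r, Sink) | r. r \<in> R}"

definition net_cap :: "nat \<Rightarrow> 'a vertex \<times> 'a vertex \<Rightarrow> nat" where
  "net_cap t e = (if snd e = Sink then t else 1)"

abbreviation net_max_flow ::
    "('a \<Rightarrow> 'a \<Rightarrow> real) \<Rightarrow> 'a set \<Rightarrow> 'a set \<Rightarrow> nat \<Rightarrow> real \<Rightarrow> ('a vertex \<times> 'a vertex \<Rightarrow> nat) \<Rightarrow> bool" where
  "net_max_flow d R B t \<theta> \<phi> \<equiv>
     max_integral_flow (net_vertices R B) (net_edges d R B \<theta>) (net_cap t) Source Sink \<phi>"

definition flow_fairlets ::
    "'a set \<Rightarrow> 'a set \<Rightarrow> ('a vertex \<times> 'a vertex \<Rightarrow> nat) \<Rightarrow> 'a set set" where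
  "flow_fairlets R B \<phi> = (\<lambda>r. {r} \<union> {b \<in> B. \<phi> (Point b, Point r) = 1}) ` R"

text \<open>A maximum flow need not be unique, so the algorithms are relations between inputs and
  possible outputs. \<open>scan_thresholds\<close> is the loop over the remaining candidate values of
  \<open>\<delta>\<close>. A loop that runs out of candidates yields no fairlets; under the hypotheses of the
  theorem this happens only for the empty metric space, where there are no candidates at all.\<close>

inductive scan_thresholds ::
    "('a \<Rightarrow> 'a \<Rightarrow> real) \<Rightarrow> real \<Rightarrow> 'a set \<Rightarrow> 'a set \<Rightarrow> nat \<Rightarrow> real list \<Rightarrow> 'a set set \<Rightarrow> bool"
  for d \<tau> R B t where
  exhausted: "scan_thresholds d \<tau> R B t [] {}"
| accept: "\<lbrakk>net_max_flow d R B t (\<tau> * \<delta>) \<phi>;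
     flow_value (net_edges d R B (\<tau> * \<delta>)) Source \<phi> = int (t * card R)\<rbrakk>
   \<Longrightarrow> scan_thresholds d \<tau> R B t (\<delta> # \<delta>s) (flow_fairlets R B \<phi>)"
| reject: "\<lbrakk>net_max_flow d R B t (\<tau> * \<delta>) \<phi>;
     flow_value (net_edges d R B (\<tau> * \<delta>)) Source \<phi> \<noteq> int (t * card R);
     scan_thresholds d \<tau> R B t \<delta>s F\<rbrakk>
   \<Longrightarrow> scan_thresholds d \<tau> R B t (\<delta> # \<delta>s) F"

definition compute_1t_fairlets ::
    "'a set \<Rightarrow> ('a \<Rightarrow> 'a \<Rightarrow> real) \<Rightarrow> real \<Rightarrow> 'a set \<Rightarrow> 'a set \<Rightarrow> nat \<Rightarrow> 'a set set \<Rightarrow> bool" where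
  "compute_1t_fairlets P d \<tau> R B t F \<longleftrightarrow>
     scan_thresholds d \<tau> R B t (sorted_list_of_set {d x y | x y. x \<in> P \<and> y \<in> P}) F"

definition compute_fairlets ::
    "'a set \<Rightarrow> ('a \<Rightarrow> 'a \<Rightarrow> real) \<Rightarrow> real \<Rightarrow> nat \<Rightarrow> (nat \<Rightarrow> 'a set) \<Rightarrow> (nat \<Rightarrow> nat) \<Rightarrow> 'a set set \<Rightarrow> bool" where
  "compute_fairlets P d \<tau> m H t F \<longleftrightarrow>
     (\<exists>\<F>. (\<forall>i\<in>{2..m}. compute_1t_fairlets P d \<tau> (H 1) (H i) (t i) (\<F> i)) \<and>
          F = (\<lambda>h. \<Union>i\<in>{2..m}. \<Union>{f \<in> \<F> i. h \<in> f}) ` H 1)"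

end

theory Submission
  imports Defs
begin

text \<open>An optimal fair clustering splits \<open>H i\<close> minus outliers and \<open>H 1\<close> into clusters in which the
  ratio is exactly \<open>t i : 1\<close>. Hence each cluster admits a \<open>t i\<close>-to-one assignment of its points
  in \<open>H i\<close> to its points in \<open>H 1\<close>, and by the triangle inequality through the centre assigned
  points are at distance at most \<open>2 * opt\<close>. The assignment is a flow saturating all edges into
  the sink, so the scan stops at some \<open>\<delta> \<le> opt\<close> (the optimum itself is a candidate), and the
  edges of the network it has built then have length at most \<open>2 * opt\<close>.\<close>

section \<open>Flows in the fairlet network\<close>

lemma ex_equitable_map:
  assumes "finite Y" "finite X" "card X = t * card Y"
  shows "\<exists>g. g ` X \<subseteq> Y \<and> (\<forall>y\<in>Y. card {x \<in> X. g x = y} = t)"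
  using assms
proof (induction Y arbitrary: X rule: finite_induct)
  case empty
  then show ?case by auto
next
  case (insert y Y)
  then have "t \<le> card X" by simp
  \<comment> \<open>\<open>S\<close> becomes the fibre over the new point \<open>y\<close>; what
    remains of \<open>X\<close> has exactly the size that the induction hypothesis demands.\<close>
  then obtain S where S: "S \<subseteq> X" "card S = t"
    by (meson obtain_subset_with_card_n)
  have "card (X - S) = t * card Y"
    using insert S by (simp add: card_Diff_subset finite_subset)
  then obtain g where g: "g ` (X - S) \<subseteq> Y" "\<forall>z\<in>Y. card {x \<in> X - S. g x = z} = t"
    using insert.IH[of "X - S"] insert.prems by auto
  define g' where "g' x = (if x \<in> S then y else g x)" for x
  have "{x \<in> X. g' x = y} = S"
    using S g insert.hyps by (auto simp: g'_def)
  moreover have "{x \<in> X. g' x = z} = {x \<in> X - S. g x = z}" if "z \<in> Y" for z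
    using that insert.hyps by (auto simp: g'_def)
  ultimately show ?case
    using g S by (intro exI[of _ g']) (auto simp: g'_def)
qed

text \<open>Equitable maps chosen separately over each value of \<open>p\<close> are glued together.
  With \<open>p\<close> the cluster assignment, \<open>g\<close> never leaves a cluster, so a point
  and its image share a centre.\<close>

lemma ex_equitable_map_fibrewise:
  assumes fin: "finite X" "finite Y"
    and sub: "p ` X \<subseteq> C" "p ` Y \<subseteq> C"
    and card: "\<And>c. c \<in> C \<Longrightarrow> card {x \<in> X. p x = c} = t * card {y \<in> Y. p y = c}"
  obtains g where "g ` X \<subseteq> Y" "\<And>x. x \<in> X \<Longrightarrow> p (g x) = p x"
    "\<And>y. y \<in> Y \<Longrightarrow> card {x \<in> X. g x = y} = t"
proof -
  define good where "good c g \<longleftrightarrow> g ` {x \<in> X. p x = c} \<subseteq> {y \<in> Y. p y = c} \<and>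
      (\<forall>y\<in>{y \<in> Y. p y = c}. card {x \<in> {x \<in> X. p x = c}. g x = y} = t)" for c g
  have "\<exists>g. good c g" if "c \<in> C" for c
    unfolding good_def using fin by (intro ex_equitable_map card that) auto
  then obtain g where "\<And>c. c \<in> C \<Longrightarrow> good c (g c)"
    by metis
  then have g: "\<And>c. c \<in> C \<Longrightarrow> g c ` {x \<in> X. p x = c} \<subseteq> {y \<in> Y. p y = c}"
    "\<And>c y. c \<in> C \<Longrightarrow> y \<in> Y \<Longrightarrow> p y = c \<Longrightarrow> card {x \<in> {x \<in> X. p x = c}. g c x = y} = t"
    unfolding good_def by blast+
  define h where "h x = g (p x) x" for x
  have h: "h x \<in> Y \<and> p (h x) = p x" if "x \<in> X" for x
    using g(1)[of "p x"] that sub by (auto simp: h_def)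
  have "card {x \<in> X. h x = y} = t" if "y \<in> Y" for y
  proof -
    have "{x \<in> X. h x = y} = {x \<in> {x \<in> X. p x = p y}. g (p y) x = y}"
      using h by (auto simp: h_def)
    then show ?thesis using g(2)[of "p y" y] that sub by auto
  qed
  then show ?thesis using that[of h] h by auto
qed

section \<open>Conservation laws in the three-layer network\<close>

locale fairlet_network =
  fixes R B :: "'a set" and d :: "'a \<Rightarrow> 'a \<Rightarrow> real"
  assumes finite_R: "finite R" and finite_B: "finite B" and disjoint: "R \<inter> B = {}"
begin

abbreviation "flow t \<theta> \<phi> \<equiv>
  integral_flow (net_vertices R B) (net_edges d R B \<theta>) (net_cap t) Source Sink \<phi>"

text \<open>Only the support of \<open>\<phi>\<close> is fixed here, not that it is a flow. The
  resulting characterisation can therefore both extract conservation laws from a given flow and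
  certify a hand-made candidate.\<close>

context
  fixes \<theta> :: real and \<phi> :: "'a vertex \<times> 'a vertex \<Rightarrow> nat"
  assumes supported: "\<And>e. e \<notin> net_edges d R B \<theta> \<Longrightarrow> \<phi> e = 0"
begin

text \<open>Disjointness of \<open>R\<close> and \<open>B\<close> leaves only edges from
  \<open>B\<close> entering a point of \<open>R\<close>. Pairs farther apart than
  \<open>\<theta>\<close> carry no flow, so the sum may run over all of \<open>B\<close>.\<close>

lemma inflow_R:
  assumes "r \<in> R"
  shows "(\<Sum>e | e \<in> net_edges d R B \<theta> \<and> snd e = Point r. \<phi> e) = (\<Sum>b\<in>B. \<phi> (Point b, Point r))"
proof -
  have "{e. e \<in> net_edges d R B \<theta> \<and> snd e = Point r} = (\<lambda>b. (Point b, Point r)) ` {b \<in> B. d b r \<le> \<theta>}"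
    using assms disjoint by (auto simp: net_edges_def)
  then have "(\<Sum>e | e \<in> net_edges d R B \<theta> \<and> snd e = Point r. \<phi> e) =
      (\<Sum>b\<in>{b \<in> B. d b r \<le> \<theta>}. \<phi> (Point b, Point r))"
    by (simp add: sum.reindex inj_on_def)
  also have "\<dots> = (\<Sum>b\<in>B. \<phi> (Point b, Point r))"
    using finite_B by (intro sum.mono_neutral_left) (auto intro!: supported simp: net_edges_def)
  finally show ?thesis .
qed

lemma outflow_R:
  assumes "r \<in> R"
  shows "(\<Sum>e | e \<in> net_edges d R B \<theta> \<and> fst e = Point r. \<phi> e) = \<phi> (Point r, Sink)"
proof -
  have "{e. e \<in> net_edges d R B \<theta> \<and> fst e = Point r} = {(Point r, Sink)}"
    using assms disjoint by (auto simp: net_edges_def)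
  then show ?thesis by simp
qed

lemma inflow_B:
  assumes "b \<in> B"
  shows "(\<Sum>e | e \<in> net_edges d R B \<theta> \<and> snd e = Point b. \<phi> e) = \<phi> (Source, Point b)"
proof -
  have "{e. e \<in> net_edges d R B \<theta> \<and> snd e = Point b} = {(Source, Point b)}"
    using assms disjoint by (auto simp: net_edges_def)
  then show ?thesis by simp
qed

lemma outflow_B:
  assumes "b \<in> B"
  shows "(\<Sum>e | e \<in> net_edges d R B \<theta> \<and> fst e = Point b. \<phi> e) = (\<Sum>r\<in>R. \<phi> (Point b, Point r))"
proof -
  have "{e. e \<in> net_edges d R B \<theta> \<and> fst e = Point b} = (\<lambda>r. (Point b, Point r)) ` {r \<in> R. d b r \<le> \<theta>}"
    using assms disjoint by (auto simp: net_edges_def)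
  then have "(\<Sum>e | e \<in> net_edges d R B \<theta> \<and> fst e = Point b. \<phi> e) =
      (\<Sum>r\<in>{r \<in> R. d b r \<le> \<theta>}. \<phi> (Point b, Point r))"
    by (simp add: sum.reindex inj_on_def)
  also have "\<dots> = (\<Sum>r\<in>R. \<phi> (Point b, Point r))"
    using finite_R by (intro sum.mono_neutral_left) (auto intro!: supported simp: net_edges_def)
  finally show ?thesis .
qed

text \<open>No edge enters the source, so the subtracted term of the value vanishes.\<close>

lemma flow_value_net: "flow_value (net_edges d R B \<theta>) Source \<phi> = int (\<Sum>b\<in>B. \<phi> (Source, Point b))"
proof -
  have edges: "{e. e \<in> net_edges d R B \<theta> \<and> fst e = Source} = (\<lambda>b. (Source, Point b)) ` B"
    "{e. e \<in> net_edges d R B \<theta> \<and> snd e = Source} = {}"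
    by (auto simp: net_edges_def)
  show ?thesis
    unfolding flow_value_def edges by (simp add: sum.reindex inj_on_def)
qed

lemma flow_iff:
  "flow t \<theta> \<phi> \<longleftrightarrow> (\<forall>e\<in>net_edges d R B \<theta>. \<phi> e \<le> net_cap t e) \<and>
     (\<forall>r\<in>R. (\<Sum>b\<in>B. \<phi> (Point b, Point r)) = \<phi> (Point r, Sink)) \<and>
     (\<forall>b\<in>B. \<phi> (Source, Point b) = (\<Sum>r\<in>R. \<phi> (Point b, Point r)))"
proof -
  have "net_vertices R B - {Source, Sink} = Point ` B \<union> Point ` R"
    by (auto simp: net_vertices_def)
  then show ?thesis
    unfolding integral_flow_def
    by (simp add: ball_Un image_iff inflow_R outflow_R inflow_B outflow_B)
      (use supported in blast)
qed

end

section \<open>Consequences of capacities and integrality\<close>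

context
  fixes \<theta> :: real and t :: nat and \<phi> :: "'a vertex \<times> 'a vertex \<Rightarrow> nat"
  assumes flow: "flow t \<theta> \<phi>"
begin

lemma flow_supported: "e \<notin> net_edges d R B \<theta> \<Longrightarrow> \<phi> e = 0"
  using flow unfolding integral_flow_def by blast

lemma flow_Sink_le: "r \<in> R \<Longrightarrow> \<phi> (Point r, Sink) \<le> t"
  using flow by (force simp: integral_flow_def net_cap_def net_edges_def)

lemma flow_Source_le: "b \<in> B \<Longrightarrow> \<phi> (Source, Point b) \<le> 1"
  using flow by (force simp: integral_flow_def net_cap_def net_edges_def)

lemma conserve_R: "r \<in> R \<Longrightarrow> (\<Sum>b\<in>B. \<phi> (Point b, Point r)) = \<phi> (Point r, Sink)"
  and conserve_B: "b \<in> B \<Longrightarrow> \<phi> (Source, Point b) = (\<Sum>r\<in>R. \<phi> (Point b, Point r))"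
  using flow flow_iff[OF flow_supported] by auto

text \<open>Double counting of the flow through the middle layer.\<close>

lemma flow_value_Sink:
  "flow_value (net_edges d R B \<theta>) Source \<phi> = int (\<Sum>r\<in>R. \<phi> (Point r, Sink))"
proof -
  have "(\<Sum>b\<in>B. \<phi> (Source, Point b)) = (\<Sum>b\<in>B. \<Sum>r\<in>R. \<phi> (Point b, Point r))"
    by (simp add: conserve_B)
  also have "\<dots> = (\<Sum>r\<in>R. \<phi> (Point r, Sink))"
    by (subst sum.swap) (simp add: conserve_R)
  finally show ?thesis by (simp add: flow_value_net flow_supported)
qed

text \<open>The edges into the sink form a cut of capacity \<open>t * card R\<close>, so the
  acceptance test of the scan asks for saturation of every one of them.\<close>

lemma flow_value_le: "flow_value (net_edges d R B \<theta>) Source \<phi> \<le> int (t * card R)"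
  using sum_bounded_above[of R "\<lambda>r. \<phi> (Point r, Sink)" t] flow_Sink_le
  by (simp add: flow_value_Sink mult.commute flip: of_nat_mult of_nat_sum)

text \<open>At most one unit enters \<open>b\<close>, which bounds each summand of its outflow. This
  covers pairs that are not edges as well.\<close>

lemma flow_Point_le:
  assumes "b \<in> B" "r \<in> R"
  shows "\<phi> (Point b, Point r) \<le> 1"
  using flow_Source_le[OF assms(1)] conserve_B[OF assms(1)]
    member_le_sum[of r R "\<lambda>r. \<phi> (Point b, Point r)"] assms finite_R by simp

text \<open>Otherwise two units would leave \<open>b\<close> while at most one enters. This is what
  makes the returned fairlets disjoint.\<close>

lemma flow_Point_unique:
  assumes "b \<in> B" "r \<in> R" "r' \<in> R" "\<phi> (Point b, Point r) = 1" "\<phi> (Point b, Point r') = 1"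
  shows "r = r'"
proof (rule ccontr)
  assume "r \<noteq> r'"
  then have "2 = (\<Sum>r\<in>{r, r'}. \<phi> (Point b, Point r))"
    using assms by simp
  also have "\<dots> \<le> (\<Sum>r\<in>R. \<phi> (Point b, Point r))"
    using assms finite_R by (intro sum_mono2) auto
  also have "\<dots> \<le> 1"
    using flow_Source_le conserve_B assms by metis
  finally show False by simp
qed

lemma flow_Point_dist: "\<phi> (Point b, Point r) = 1 \<Longrightarrow> d b r \<le> \<theta>"
  using flow_supported[of "(Point b, Point r)"] by (auto simp: net_edges_def)

text \<open>The sink edges carry at most \<open>t\<close> each and \<open>t * card R\<close> in
  total, hence exactly \<open>t\<close> each. By integrality the flows into \<open>r\<close> are 0
  or 1, so their sum counts the points matched to \<open>r\<close>.\<close>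

lemma card_saturated_fairlet:
  assumes val: "flow_value (net_edges d R B \<theta>) Source \<phi> = int (t * card R)" and r: "r \<in> R"
  shows "card {b \<in> B. \<phi> (Point b, Point r) = 1} = t"
proof -
  have "(\<Sum>r\<in>R. \<phi> (Point r, Sink)) = (\<Sum>r\<in>R. t)"
    using val flow_value_Sink by (simp add: mult.commute flip: of_nat_mult of_nat_sum)
  then have "\<phi> (Point r, Sink) = t"
    using flow_Sink_le r finite_R by (rule sum_mono_inv)
  then have "t = (\<Sum>b\<in>B. \<phi> (Point b, Point r))"
    using conserve_R r by simp
  also have "\<dots> = (\<Sum>b\<in>B. of_bool (\<phi> (Point b, Point r) = 1))"
    using flow_Point_le r by (intro sum.cong) (auto simp: le_Suc_eq)
  also have "\<dots> = card {b \<in> B. \<phi> (Point b, Point r) = 1}"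
    using finite_B by (simp add: Int_def)
  finally show ?thesis by simp
qed

end

section \<open>Existence of flows and the scan over thresholds\<close>

lemma ex_max_flow: "\<exists>\<phi>. net_max_flow d R B t \<theta> \<phi>"
proof -
  let ?val = "flow_value (net_edges d R B \<theta>) Source"
  have zero: "flow t \<theta> (\<lambda>_. 0)"
    by (simp add: integral_flow_def)
  \<comment> \<open>Nonnegativity lets the integer values be compared through \<open>nat\<close>,
    where a bounded nonempty set of values has a greatest element.\<close>
  have nonneg: "?val \<phi> \<ge> 0" if "flow t \<theta> \<phi>" for \<phi>
    by (simp add: flow_value_Sink[OF that] sum_nonneg)
  have bound: "\<forall>\<phi>. flow t \<theta> \<phi> \<longrightarrow> nat (?val \<phi>) < Suc (t * card R)"
    using flow_value_le by (simp only: less_Suc_eq_le nat_le_iff) blast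
  obtain \<phi> where \<phi>: "flow t \<theta> \<phi>" "\<forall>\<psi>. flow t \<theta> \<psi> \<longrightarrow> nat (?val \<psi>) \<le> nat (?val \<phi>)"
    using ex_has_greatest_nat[OF zero bound] by blast
  then show ?thesis
    unfolding max_integral_flow_def using nonneg by (intro exI[of _ \<phi>]) (simp add: nat_le_eq_zle)
qed

lemma ex_saturating_flow:
  assumes S: "S \<subseteq> B" "g ` S \<subseteq> R" "\<And>b. b \<in> S \<Longrightarrow> d b (g b) \<le> \<theta>"
    and fibre: "\<And>r. r \<in> R \<Longrightarrow> card {b \<in> S. g b = r} = t"
  shows "\<exists>\<phi>. flow t \<theta> \<phi> \<and> flow_value (net_edges d R B \<theta>) Source \<phi> = int (t * card R)"
proof -
  \<comment> \<open>Each \<open>b\<close> in \<open>S\<close> sends one unit along the path through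
    \<open>g b\<close>; points of \<open>B\<close> outside \<open>S\<close> carry nothing.\<close>
  define \<phi> :: "'a vertex \<times> 'a vertex \<Rightarrow> nat" where
    "\<phi> e = (case e of
        (Source, Point b) \<Rightarrow> of_bool (b \<in> S)
      | (Point b, Point r) \<Rightarrow> of_bool (b \<in> S \<and> g b = r)
      | (Point r, Sink) \<Rightarrow> if r \<in> R then t else 0
      | _ \<Rightarrow> 0)" for e
  have supp: "\<phi> e = 0" if "e \<notin> net_edges d R B \<theta>" for e
    using that S(1,3) image_subset_iff[THEN iffD1, OF S(2)]
    by (auto simp: \<phi>_def net_edges_def split: prod.splits vertex.splits)
  have cap: "\<phi> e \<le> net_cap t e" for e
    by (auto simp: \<phi>_def net_cap_def split: prod.splits vertex.splits)
  have R: "(\<Sum>b\<in>B. \<phi> (Point b, Point r)) = \<phi> (Point r, Sink)" if "r \<in> R" for r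
  proof -
    have "B \<inter> {b. b \<in> S \<and> g b = r} = {b \<in> S. g b = r}" using S by auto
    then show ?thesis
      using that fibre finite_B by (simp add: \<phi>_def)
  qed
  have B: "\<phi> (Source, Point b) = (\<Sum>r\<in>R. \<phi> (Point b, Point r))" if "b \<in> B" for b
  proof (cases "b \<in> S")
    case True
    then have "R \<inter> {r. g b = r} = {g b}" using S by auto
    with True show ?thesis using finite_R by (simp add: \<phi>_def)
  qed (simp add: \<phi>_def)
  have flow: "flow t \<theta> \<phi>"
    using flow_iff[OF supp] cap R B by auto
  moreover have "flow_value (net_edges d R B \<theta>) Source \<phi> = int (t * card R)"
    by (simp add: flow_value_Sink[OF flow] \<phi>_def mult.commute)
  ultimately show ?thesis by blast
qed

text \<open>The algorithm is a relation, so the existence of an output needs proof: every threshold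
  has a maximum flow, and its value selects acceptance or rejection.\<close>

lemma ex_scan: "\<exists>F. scan_thresholds d \<tau> R B t \<delta>s F"
proof (induction \<delta>s)
  case Nil
  then show ?case using scan_thresholds.exhausted by blast
next
  case (Cons \<delta> \<delta>s)
  then show ?case
    using ex_max_flow[where t = t and \<theta> = "\<tau> * \<delta>"] scan_thresholds.accept scan_thresholds.reject by metis
qed

text \<open>A candidate that admits a saturating flow cannot be rejected, and the candidates come in
  increasing order, so the scan stops at \<open>\<delta>0\<close> or earlier.\<close>

lemma scan_accepts:
  assumes "scan_thresholds d \<tau> R B t \<delta>s F" "sorted \<delta>s" "\<delta>0 \<in> set \<delta>s"
    and "\<exists>\<phi>. flow t (\<tau> * \<delta>0) \<phi> \<and>
      flow_value (net_edges d R B (\<tau> * \<delta>0)) Source \<phi> = int (t * card R)"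
  shows "\<exists>\<delta> \<phi>. \<delta> \<le> \<delta>0 \<and> flow t (\<tau> * \<delta>) \<phi> \<and>
      flow_value (net_edges d R B (\<tau> * \<delta>)) Source \<phi> = int (t * card R) \<and> F = flow_fairlets R B \<phi>"
  using assms
proof (induction rule: scan_thresholds.induct)
  case exhausted
  then show ?case by simp
next
  case (accept \<delta> \<phi> \<delta>s)
  then show ?case
    unfolding max_integral_flow_def by (intro exI[of _ \<delta>] exI[of _ \<phi>]) auto
next
  case (reject \<delta> \<phi> \<delta>s F)
  \<comment> \<open>A maximum flow at \<open>\<delta>0\<close> is at least as large as the
    saturating one and no larger than the cut, so it would have been accepted. Hence
    \<open>\<delta>0\<close> lies in the tail.\<close>
  have "\<delta>0 \<noteq> \<delta>"
  proof
    assume "\<delta>0 = \<delta>"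
    then have "int (t * card R) \<le> flow_value (net_edges d R B (\<tau> * \<delta>)) Source \<phi>"
      using reject.prems(3) reject.hyps(1) unfolding max_integral_flow_def by metis
    moreover have "flow_value (net_edges d R B (\<tau> * \<delta>)) Source \<phi> \<le> int (t * card R)"
      using reject.hyps(1) flow_value_le unfolding max_integral_flow_def by blast
    ultimately show False using reject.hyps(2) by simp
  qed
  then show ?case using reject by auto
qed

end

section \<open>Optimal fair clusterings\<close>

text \<open>A single cluster suffices: all of \<open>H 1\<close> together with
  \<open>t i * card (H 1)\<close> points of each other class, around any centre in
  \<open>H 1\<close>. Feasibility ensures that the optimum is a minimum over a nonempty set.\<close>

lemma ex_fair_clustering:
  assumes fin: "finite P" and P: "P = (\<Union>i\<in>{1..m}. H i)" and disj: "disjoint_family_on H {1..m}"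
    and t1: "t 1 = 1" and le: "\<And>i. i \<in> {2..m} \<Longrightarrow> card (H i) \<ge> t i * card (H 1)"
    and m: "m \<ge> 1" and k: "k \<ge> 1"
  shows "\<exists>C \<alpha>. fair_clustering P m H t k C \<alpha>"
proof (cases "H 1 = {}")
  case True
  \<comment> \<open>With no anchors the prescribed number of outliers is all of \<open>H i\<close>,
    so every point is an outlier and no centre is opened.\<close>
  then show ?thesis
    by (intro exI[of _ "{}"] exI[of _ "\<lambda>_. None"]) (simp add: fair_clustering_def)
next
  case False
  then obtain c where c: "c \<in> H 1" by blast
  have "\<exists>S. S \<subseteq> H i \<and> card S = t i * card (H 1)" if "i \<in> {1..m}" for i
  proof -
    have "t i * card (H 1) \<le> card (H i)"
      using le[of i] t1 that by (cases "i = 1") auto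
    then show ?thesis by (meson obtain_subset_with_card_n)
  qed
  then obtain S where S: "\<And>i. i \<in> {1..m} \<Longrightarrow> S i \<subseteq> H i"
    "\<And>i. i \<in> {1..m} \<Longrightarrow> card (S i) = t i * card (H 1)"
    by metis
  have finH: "finite (H i)" if "i \<in> {1..m}" for i
    using fin P that by (auto intro: finite_subset)
  \<comment> \<open>Since \<open>t 1 = 1\<close>, the chosen subset of \<open>H 1\<close> has full
    size, so no anchor becomes an outlier.\<close>
  have S1: "S 1 = H 1"
    using card_subset_eq[of "H 1" "S 1"] S[of 1] finH[of 1] m t1 by simp
  define U where "U = (\<Union>i\<in>{1..m}. S i)"
  have UH: "U \<inter> H i = S i" if i: "i \<in> {1..m}" for i
  proof -
    have "S j \<inter> H i \<subseteq> S i" if j: "j \<in> {1..m}" for j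
      using S(1)[OF j] disjoint_family_onD[OF disj i j] by (cases "i = j") auto
    then show ?thesis using S(1)[OF i] i unfolding U_def by blast
  qed
  define \<alpha> where "\<alpha> x = (if x \<in> U then Some c else None)" for x
  have Q: "{x \<in> P. \<alpha> x = Some c} \<inter> H i = S i" if "i \<in> {1..m}" for i
  proof -
    have "{x \<in> P. \<alpha> x = Some c} \<inter> H i = U \<inter> H i"
      using that by (auto simp: \<alpha>_def P)
    then show ?thesis by (simp add: UH[OF that])
  qed
  have out: "{x \<in> H i. \<alpha> x = None} = H i - S i" if "i \<in> {1..m}" for i
    using UH[OF that] by (auto simp: \<alpha>_def)
  have "fair_clustering P m H t k {c} \<alpha>"
    unfolding fair_clustering_def
  proof (intro conjI)
    show "{c} \<subseteq> P" using c P m by auto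
    show "\<forall>c\<in>{c}. let Q = {x \<in> P. \<alpha> x = Some c} in
        \<forall>i\<in>{1..m}. card (Q \<inter> H i) = t i * card (Q \<inter> H 1)"
      using Q Q[of 1] S S1 m by (simp add: Let_def)
    show "{x \<in> H 1. \<alpha> x = None} = {}"
      using out[of 1] S1 m by auto
    show "\<forall>i\<in>{2..m}. card {x \<in> H i. \<alpha> x = None} = card (H i) - t i * card (H 1)"
    proof
      fix i assume "i \<in> {2..m}"
      then have i: "i \<in> {1..m}" by simp
      show "card {x \<in> H i. \<alpha> x = None} = card (H i) - t i * card (H 1)"
        using S[OF i] finite_subset[OF S(1)[OF i] finH[OF i]]
        by (simp add: out[OF i] card_Diff_subset)
    qed
  qed (use k in \<open>auto simp: \<alpha>_def\<close>)
  then show ?thesis by blast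
qed

section \<open>Clustering costs and the optimum\<close>

context Metric_space
begin

context
  fixes m k :: nat and H :: "nat \<Rightarrow> 'a set" and t :: "nat \<Rightarrow> nat"
  assumes fin: "finite M"
begin

lemma finite_dists: "finite {d x y | x y. x \<in> M \<and> y \<in> M}"
  using fin by (intro finite_image_set2) auto

lemma finite_costs: "finite {d x (the (\<alpha> x)) | x. x \<in> M \<and> \<alpha> x \<noteq> None}"
  using fin by simp

lemma clustering_cost_ge: "x \<in> M \<Longrightarrow> \<alpha> x = Some c \<Longrightarrow> d x c \<le> clustering_cost M d \<alpha>"
  unfolding clustering_cost_def using finite_costs[of \<alpha>] by (intro Max_ge) force+

text \<open>Serves two purposes: costs range over a finite set, and a cost is a candidate threshold
  once \<open>0\<close> is known to be a distance.\<close>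

lemma clustering_cost_mem:
  assumes "fair_clustering M m H t k C \<alpha>"
  shows "clustering_cost M d \<alpha> \<in> insert 0 {d x y | x y. x \<in> M \<and> y \<in> M}"
proof -
  have "clustering_cost M d \<alpha> \<in> insert 0 {d x (the (\<alpha> x)) | x. x \<in> M \<and> \<alpha> x \<noteq> None}"
    unfolding clustering_cost_def using finite_costs[of \<alpha>] by (intro Max_in) auto
  moreover have "the (\<alpha> x) \<in> M" if "x \<in> M" "\<alpha> x \<noteq> None" for x
    using assms that unfolding fair_clustering_def by fastforce
  ultimately show ?thesis by blast
qed

text \<open>There may be infinitely many maps \<open>\<alpha>\<close>, as their values off
  \<open>M\<close> are free, but their costs lie in a finite set of reals.\<close>

lemma opt_fair_attained:
  assumes "\<exists>C \<alpha>. fair_clustering M m H t k C \<alpha>"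
  obtains C \<alpha> where "fair_clustering M m H t k C \<alpha>" "clustering_cost M d \<alpha> = opt_fair M d m H t k"
proof -
  let ?X = "{clustering_cost M d \<alpha> | C \<alpha>. fair_clustering M m H t k C \<alpha>}"
  have "?X \<subseteq> insert 0 {d x y | x y. x \<in> M \<and> y \<in> M}"
    using clustering_cost_mem by blast
  then have "finite ?X"
    using finite_dists by (meson finite_insert finite_subset)
  moreover have "?X \<noteq> {}" using assms by auto
  ultimately have "opt_fair M d m H t k \<in> ?X"
    unfolding opt_fair_def by (rule Min_in)
  then show ?thesis using that by auto
qed

text \<open>\<open>S\<close> collects the points of \<open>H i\<close> that are not outliers.
  Fairness of each cluster is exactly the fibre condition for an equitable map with
  \<open>\<alpha>\<close> as the projection.\<close>

lemma fair_clustering_assignment: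
  assumes clus: "fair_clustering M m H t k C \<alpha>" and i: "i \<in> {1..m}"
    and H1: "H 1 \<subseteq> M" and Hi: "H i \<subseteq> M"
  obtains S g where "S \<subseteq> H i" "g ` S \<subseteq> H 1"
    "\<And>b. b \<in> S \<Longrightarrow> d b (g b) \<le> 2 * clustering_cost M d \<alpha>"
    "\<And>r. r \<in> H 1 \<Longrightarrow> card {b \<in> S. g b = r} = t i"
proof -
  define S where "S = {x \<in> H i. \<alpha> x \<noteq> None}"
  have \<alpha>: "\<alpha> x \<in> Some ` C" if "x \<in> M" "\<alpha> x \<noteq> None" for x
    using clus that unfolding fair_clustering_def by auto
  have \<alpha>1: "\<alpha> x \<noteq> None" if "x \<in> H 1" for x
    using clus that unfolding fair_clustering_def by auto
  have fin': "finite S" "finite (H 1)"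
    using fin H1 Hi by (auto simp: S_def intro: finite_subset)
  have card: "card {x \<in> S. \<alpha> x = c} = t i * card {x \<in> H 1. \<alpha> x = c}" if c: "c \<in> Some ` C" for c
  proof -
    obtain c' where c': "c = Some c'" "c' \<in> C" using c by blast
    have eqs: "{x \<in> S. \<alpha> x = c} = {x \<in> M. \<alpha> x = Some c'} \<inter> H i"
      "{x \<in> H 1. \<alpha> x = c} = {x \<in> M. \<alpha> x = Some c'} \<inter> H 1"
      using c' H1 Hi by (auto simp: S_def)
    show ?thesis
      unfolding eqs using clus c'(2) i unfolding fair_clustering_def Let_def by blast
  qed
  obtain g where g: "g ` S \<subseteq> H 1" "\<And>x. x \<in> S \<Longrightarrow> \<alpha> (g x) = \<alpha> x"
    "\<And>y. y \<in> H 1 \<Longrightarrow> card {x \<in> S. g x = y} = t i"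
  proof (rule ex_equitable_map_fibrewise[OF fin', of \<alpha> "Some ` C" "t i"])
    show "\<alpha> ` S \<subseteq> Some ` C" "\<alpha> ` H 1 \<subseteq> Some ` C"
      using \<alpha> \<alpha>1 H1 Hi unfolding S_def by blast+
  qed (use card in auto)
  have "d b (g b) \<le> 2 * clustering_cost M d \<alpha>" if b: "b \<in> S" for b
  proof -
    have M: "b \<in> M" "g b \<in> M" using b g(1) H1 Hi by (auto simp: S_def)
    obtain c where c: "\<alpha> b = Some c" "c \<in> M"
      using \<alpha>[of b] M b clus by (auto simp: S_def fair_clustering_def)
    have "d b (g b) \<le> d b c + d (g b) c"
      using triangle[of b c "g b"] commute M c by metis
    also have "\<dots> \<le> clustering_cost M d \<alpha> + clustering_cost M d \<alpha>"
      using clustering_cost_ge[of _ \<alpha> c] g(2)[OF b] M c by (intro add_mono) auto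
    finally show ?thesis by simp
  qed
  moreover have "S \<subseteq> H i" by (auto simp: S_def)
  ultimately show ?thesis using that g(1,3) by blast
qed

text \<open>Stated for any fair clustering, to be applied to an optimal one. Naming the non-anchor
  part \<open>N r\<close> of each fairlet makes merging over the colours easy.\<close>

lemma compute_1t_fairlets_correct:
  assumes F: "compute_1t_fairlets M d 2 (H 1) (H i) (t i) F"
    and clus: "fair_clustering M m H t k C \<alpha>" and i: "i \<in> {1..m}"
    and H1: "H 1 \<subseteq> M" and Hi: "H i \<subseteq> M" and disj: "H 1 \<inter> H i = {}" and ne: "M \<noteq> {}"
  shows "\<exists>N. F = (\<lambda>r. insert r (N r)) ` H 1 \<and>
    (\<forall>r\<in>H 1. N r \<subseteq> H i \<and> card (N r) = t i \<and> (\<forall>b\<in>N r. d r b \<le> 2 * clustering_cost M d \<alpha>)) \<and>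
    disjoint_family_on N (H 1)"
proof -
  interpret N: fairlet_network "H 1" "H i" d
    using fin H1 Hi disj by unfold_locales (auto intro: finite_subset)
  let ?cost = "clustering_cost M d \<alpha>"
  obtain x where x: "x \<in> M" using ne by blast
  \<comment> \<open>The default cost \<open>0\<close> is the distance of a point to itself, so the
    cost is a candidate in every case.\<close>
  have "0 \<in> {d x y | x y. x \<in> M \<and> y \<in> M}"
    using x by (intro CollectI exI[of _ x]) simp
  then have "?cost \<in> {d x y | x y. x \<in> M \<and> y \<in> M}"
    using clustering_cost_mem[OF clus] by (simp only: insert_absorb)
  then have mem: "?cost \<in> set (sorted_list_of_set {d x y | x y. x \<in> M \<and> y \<in> M})"
    using finite_dists by simp
  obtain S g where "S \<subseteq> H i" "g ` S \<subseteq> H 1"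
    "\<And>b. b \<in> S \<Longrightarrow> d b (g b) \<le> 2 * ?cost"
    "\<And>r. r \<in> H 1 \<Longrightarrow> card {b \<in> S. g b = r} = t i"
    using fair_clustering_assignment[OF clus i H1 Hi] by blast
  note sat = N.ex_saturating_flow[OF this]
  obtain \<delta> \<phi> where \<delta>: "\<delta> \<le> ?cost" and flow: "N.flow (t i) (2 * \<delta>) \<phi>"
    and val: "flow_value (net_edges d (H 1) (H i) (2 * \<delta>)) Source \<phi> = int (t i * card (H 1))"
    and F': "F = flow_fairlets (H 1) (H i) \<phi>"
    using N.scan_accepts[OF F[unfolded compute_1t_fairlets_def] sorted_sorted_list_of_set mem sat]
    by blast
  define N where "N r = {b \<in> H i. \<phi> (Point b, Point r) = 1}" for r
  have "d r b \<le> 2 * ?cost" if "b \<in> N r" for r b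
  proof -
    have "d b r \<le> 2 * \<delta>"
      using that N.flow_Point_dist[OF flow] by (auto simp: N_def)
    then show ?thesis using \<delta> commute[of r b] by linarith
  qed
  moreover have "disjoint_family_on N (H 1)"
    unfolding disjoint_family_on_def N_def using N.flow_Point_unique[OF flow] by blast
  moreover have "F = (\<lambda>r. insert r (N r)) ` H 1"
    by (simp add: F' flow_fairlets_def N_def)
  moreover have "N r \<subseteq> H i" for r
    by (auto simp: N_def)
  moreover have "card (N r) = t i" if "r \<in> H 1" for r
    unfolding N_def by (rule N.card_saturated_fairlet[OF flow val that])
  ultimately show ?thesis by blast
qed

end

end

section \<open>Fairlet decompositions\<close>

text \<open>Disjoint fairlets have distinct anchors, so a family using every point of \<open>H 1\<close> is maximal.\<close>

lemma fairlet_decomposition_if_covers: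
  assumes F: "disjoint_fairlets P m H t F" and cov: "H 1 \<subseteq> \<Union>F" and t: "t 1 \<noteq> 0" and m: "m \<ge> 1"
  shows "fairlet_decomposition P m H t F"
  unfolding fairlet_decomposition_def
proof (intro conjI allI impI F)
  fix G assume G: "disjoint_fairlets P m H t G \<and> F \<subseteq> G"
  have "g \<in> F" if g: "g \<in> G" for g
  proof -
    have "card (g \<inter> H 1) = t 1"
      using G g m by (simp add: disjoint_fairlets_def fairlet_def)
    then have "g \<inter> H 1 \<noteq> {}" using t by auto
    then obtain h where h: "h \<in> g" "h \<in> H 1" by blast
    then obtain f where f: "f \<in> F" "h \<in> f" using cov by auto
    then have "f = g"
      using G g h unfolding disjoint_fairlets_def pairwise_def disjnt_def by blast
    with f show ?thesis by simp
  qed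
  with G show "G = F" by blast
qed

lemma anchor_eq: "f \<inter> H 1 = {h} \<Longrightarrow> anchor H f = h"
  unfolding anchor_def by simp

text \<open>As the classes are disjoint, a merged set meets \<open>H i\<close> in
  \<open>N i h\<close> alone and \<open>H 1\<close> in \<open>h\<close> alone. Cardinalities and
  disjointness can then be checked one colour at a time.\<close>

lemma union_of_fairlets_decomposition:
  assumes P: "P = (\<Union>i\<in>{1..m}. H i)" and disj: "disjoint_family_on H {1..m}"
    and t1: "t 1 = 1" and m: "m \<ge> 2"
    and sub: "\<And>i h. i \<in> {2..m} \<Longrightarrow> h \<in> H 1 \<Longrightarrow> N i h \<subseteq> H i"
    and card: "\<And>i h. i \<in> {2..m} \<Longrightarrow> h \<in> H 1 \<Longrightarrow> card (N i h) = t i"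
    and dj: "\<And>i. i \<in> {2..m} \<Longrightarrow> disjoint_family_on (N i) (H 1)"
  shows "fairlet_decomposition P m H t ((\<lambda>h. insert h (\<Union>i\<in>{2..m}. N i h)) ` H 1)"
    and "\<And>h. h \<in> H 1 \<Longrightarrow> anchor H (insert h (\<Union>i\<in>{2..m}. N i h)) = h"
proof -
  let ?f = "\<lambda>h. insert h (\<Union>i\<in>{2..m}. N i h)"
  have Hdj: "H i \<inter> H j = {}" if "i \<in> {1..m}" "j \<in> {1..m}" "i \<noteq> j" for i j
    using disj that by (auto simp: disjoint_family_on_def)
  have Ndj: "N i h \<inter> H j = {}" if "i \<in> {2..m}" "j \<in> {1..m}" "i \<noteq> j" "h \<in> H 1" for i j h
    using Hdj[of i j] sub[of i h] that by auto
  have f1: "?f h \<inter> H 1 = {h}" if "h \<in> H 1" for h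
    using Ndj[of _ 1 h] that m by fastforce
  show anch: "anchor H (?f h) = h" if "h \<in> H 1" for h
    using f1[OF that] by (rule anchor_eq)
  have fi: "?f h \<inter> H i = N i h" if h: "h \<in> H 1" and i: "i \<in> {2..m}" for h i
  proof -
    have "h \<notin> H i" using Hdj[of 1 i] h i m by auto
    moreover have "N j h \<inter> H i \<subseteq> N i h" if "j \<in> {2..m}" for j
      using Ndj[of j i h] h i that by (cases "j = i") auto
    ultimately show ?thesis using sub[OF i h] i by blast
  qed
  have "fairlet P m H t (?f h)" if h: "h \<in> H 1" for h
    unfolding fairlet_def
  proof (intro conjI ballI)
    show "?f h \<subseteq> P"
      using sub[OF _ h] h m by (fastforce simp: P)
    show "card (?f h \<inter> H i) = t i" if "i \<in> {1..m}" for i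
      using f1[OF h] fi[OF h, of i] card[OF _ h, of i] t1 that by (cases "i = 1") auto
  qed
  moreover have "?f h \<inter> ?f h' = {}" if h: "h \<in> H 1" "h' \<in> H 1" "h \<noteq> h'" for h h'
  proof (intro equals0I)
    fix x assume "x \<in> ?f h \<inter> ?f h'"
    then have x: "x \<in> ?f h" "x \<in> ?f h'" by (rule IntD1, rule IntD2)
    \<comment> \<open>A common point is either an anchor, forcing \<open>h = h'\<close>, or has some
      colour \<open>i\<close>, contradicting disjointness within that colour.\<close>
    show False
    proof (cases "x \<in> H 1")
      case True
      then have "x \<in> {h}" "x \<in> {h'}"
        using IntI[OF x(1) True] IntI[OF x(2) True] by (simp_all only: f1 h)
      then show False using h(3) by simp
    next
      case False
      with x(1) h(1) obtain i where i: "i \<in> {2..m}" "x \<in> N i h" by blast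
      then have "x \<in> H i" using sub h(1) by blast
      then have "x \<in> ?f h' \<inter> H i" by (rule IntI[OF x(2)])
      then have "x \<in> N i h'" by (simp only: fi[OF h(2) i(1)])
      then show False
        using disjoint_family_onD[OF dj[OF i(1)] h] i(2) by blast
    qed
  qed
  then have "pairwise disjnt (?f ` H 1)"
    unfolding pairwise_image disjnt_def by (intro pairwiseI) metis
  ultimately have "disjoint_fairlets P m H t (?f ` H 1)"
    unfolding disjoint_fairlets_def by (intro conjI ballI) (auto simp only: image_iff)
  then show "fairlet_decomposition P m H t (?f ` H 1)"
    by (rule fairlet_decomposition_if_covers) (use t1 m in auto)
qed

section \<open>The algorithm for all colours\<close>

theorem corollaryC2:
  fixes P :: "'a set" and d :: "'a \<Rightarrow> 'a \<Rightarrow> real"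
    and H :: "nat \<Rightarrow> 'a set" and t :: "nat \<Rightarrow> nat" and m k :: nat
  assumes "Metric_space P d" and "finite P"
    and "m \<ge> 2"
    and "P = (\<Union>i\<in>{1..m}. H i)" and "disjoint_family_on H {1..m}"
    and "t 1 = 1"
    and "\<And>i. i \<in> {2..m} \<Longrightarrow> card (H i) \<ge> t i * card (H 1)"
    and "k \<ge> 1"
  shows "(\<exists>F. compute_fairlets P d 2 m H t F) \<and>
         (\<forall>F. compute_fairlets P d 2 m H t F \<longrightarrow>
            fairlet_decomposition P m H t F \<and>
            (\<forall>f\<in>F. \<forall>p \<in> f \<inter> (\<Union>i\<in>{2..m}. H i).
               d (anchor H f) p \<le> 2 * opt_fair P d m H t k))"
proof (intro conjI allI impI)
  interpret Metric_space P d by fact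
  have HP: "H i \<subseteq> P" if "i \<in> {1..m}" for i
    using that assms(4) by auto
  have H1P: "H 1 \<subseteq> P" using HP[of 1] assms(3) by auto
  have disj: "H 1 \<inter> H i = {}" if "i \<in> {2..m}" for i
    using disjoint_family_onD[OF assms(5), of 1 i] that by auto
  have "\<exists>F. compute_1t_fairlets P d 2 (H 1) (H i) (t i) F" if "i \<in> {2..m}" for i
  proof -
    interpret fairlet_network "H 1" "H i" d
      using assms(2) H1P HP[of i] disj[OF that] that by unfold_locales (auto intro: finite_subset)
    show ?thesis unfolding compute_1t_fairlets_def by (rule ex_scan)
  qed
  then show "\<exists>F. compute_fairlets P d 2 m H t F"
    unfolding compute_fairlets_def by metis

  fix F assume "compute_fairlets P d 2 m H t F"
  then obtain \<F> where \<F>: "\<forall>i\<in>{2..m}. compute_1t_fairlets P d 2 (H 1) (H i) (t i) (\<F> i)"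
    and F: "F = (\<lambda>h. \<Union>i\<in>{2..m}. \<Union>{f \<in> \<F> i. h \<in> f}) ` H 1"
    unfolding compute_fairlets_def by blast
  obtain C \<alpha> where clus: "fair_clustering P m H t k C \<alpha>"
    and opt: "clustering_cost P d \<alpha> = opt_fair P d m H t k"
    using opt_fair_attained[OF assms(2) ex_fair_clustering[OF assms(2,4,5,6,7)]] assms(3,8) by auto
  \<comment> \<open>The shape of \<open>\<F> i\<close> is demanded only for nonempty
    \<open>H 1\<close>, where the space is nonempty as the correctness of the scan presupposes. For
    empty \<open>H 1\<close> the returned family is empty whatever the scans yield.\<close>
  define good where "good i N \<longleftrightarrow> (H 1 \<noteq> {} \<longrightarrow> \<F> i = (\<lambda>r. insert r (N r)) ` H 1) \<and>
      (\<forall>r\<in>H 1. N r \<subseteq> H i \<and> card (N r) = t i \<and> (\<forall>b\<in>N r. d r b \<le> 2 * opt_fair P d m H t k)) \<and>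
      disjoint_family_on N (H 1)" for i N
  have "\<exists>N. good i N" if i: "i \<in> {2..m}" for i
  proof (cases "H 1 = {}")
    case False
    then have "P \<noteq> {}" using H1P by auto
    moreover have i': "i \<in> {1..m}" using i by auto
    ultimately have "\<exists>N. \<F> i = (\<lambda>r. insert r (N r)) ` H 1 \<and>
      (\<forall>r\<in>H 1. N r \<subseteq> H i \<and> card (N r) = t i \<and> (\<forall>b\<in>N r. d r b \<le> 2 * opt_fair P d m H t k)) \<and>
      disjoint_family_on N (H 1)"
      using compute_1t_fairlets_correct[OF assms(2) bspec[OF \<F> i] clus i' H1P HP[OF i'] disj[OF i]]
      by (simp add: opt)
    then show ?thesis unfolding good_def by blast
  qed (simp add: good_def disjoint_family_on_def)
  then obtain N where N: "\<And>i. i \<in> {2..m} \<Longrightarrow> good i (N i)" by metis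
  let ?f = "\<lambda>h. insert h (\<Union>i\<in>{2..m}. N i h)"
  have "(\<Union>i\<in>{2..m}. \<Union>{f \<in> \<F> i. h \<in> f}) = ?f h" if h: "h \<in> H 1" for h
  proof -
    have "\<Union>{f \<in> \<F> i. h \<in> f} = insert h (N i h)" if i: "i \<in> {2..m}" for i
    proof -
      \<comment> \<open>Hence \<open>h\<close> lies in no fairlet of colour \<open>i\<close> but its
        own, and the filter selects exactly one set.\<close>
      have "h \<notin> N i r" if "r \<in> H 1" for r
        using N[OF i] disj[OF i] h that unfolding good_def by blast
      then have "{f \<in> \<F> i. h \<in> f} = {insert h (N i h)}"
        using N[OF i] h unfolding good_def by auto
      then show ?thesis by simp
    qed
    \<comment> \<open>For \<open>m \<ge> 2\<close> the union ranges over at least one colour, so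
      \<open>h\<close> itself belongs to it.\<close>
    then show ?thesis using assms(3) by auto
  qed
  then have F_eq: "F = ?f ` H 1" unfolding F by (auto intro!: image_cong)
  have sub: "\<And>i h. i \<in> {2..m} \<Longrightarrow> h \<in> H 1 \<Longrightarrow> N i h \<subseteq> H i"
    and card: "\<And>i h. i \<in> {2..m} \<Longrightarrow> h \<in> H 1 \<Longrightarrow> card (N i h) = t i"
    and dj: "\<And>i. i \<in> {2..m} \<Longrightarrow> disjoint_family_on (N i) (H 1)"
    and dist: "\<And>i h b. i \<in> {2..m} \<Longrightarrow> h \<in> H 1 \<Longrightarrow> b \<in> N i h \<Longrightarrow> d h b \<le> 2 * opt_fair P d m H t k"
    using N unfolding good_def by blast+
  note dec = union_of_fairlets_decomposition[where N = N, OF assms(4,5,6,3) sub card dj]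
  show "fairlet_decomposition P m H t F"
    unfolding F_eq by (rule dec(1))
  show "\<forall>f\<in>F. \<forall>p \<in> f \<inter> (\<Union>i\<in>{2..m}. H i). d (anchor H f) p \<le> 2 * opt_fair P d m H t k"
  proof (intro ballI)
    fix f p assume "f \<in> F" and p: "p \<in> f \<inter> (\<Union>i\<in>{2..m}. H i)"
    then obtain h where h: "h \<in> H 1" "f = ?f h" unfolding F_eq by auto
    \<comment> \<open>The point \<open>p\<close> has a colour other than 1, so it differs from the
      anchor \<open>h\<close> and comes from some \<open>N i h\<close>.\<close>
    then obtain i where "i \<in> {2..m}" "p \<in> N i h" using p disj by blast
    then show "d (anchor H f) p \<le> 2 * opt_fair P d m H t k"
      using dist h dec(2) by simp
  qed
qed

end
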